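(* Let $U : \mathcal{A} \rightarrow \mathcal{B}$ be a local right adjoint, and let $u : A_1 \rightarrow A_2$ be any morphism in $\mathcal{A}$. Then the Beck-Chevalley condition holds at $u$: the canonical natural transformation $$\sigma^u : L_{A_2}\circ (\mathcal{B}/U(u)) \Rightarrow (\mathcal{A}/u)\circ L_{A_1}$$ of functors $\mathcal{B}/U(A_1)\to\mathcal{A}/A_2$ is a pointwise isomorphism.
   Context: A functor $U : \mathcal{A} \rightarrow \mathcal{B}$ is a local right adjoint if for each object $A$ of $\mathcal{A}$ the functor on slices $U_A : \mathcal{A}/A \rightarrow \mathcal{B}/U(A)$, $(v: A'\to A)\mapsto (U(v): U(A')\to U(A))$, has a left adjoint $L_A : \mathcal{B}/U(A) \rightarrow \mathcal{A}/A$; write $\eta^A$ and $\epsilon^A$ for the unit and counit of $L_A\dashv U_A$. For $u : A_1\to A_2$ in $\mathcal{A}$, $\mathcal{A}/u : \mathcal{A}/A_1\to\mathcal{A}/A_2$ and $\mathcal{B}/U(u):\mathcal{B}/U(A_1)\to\mathcal{B}/U(A_2)$ denote postcomposition with $u$ and with $U(u)$. Functoriality of $U$ gives $(\mathcal{B}/U(u))\circ U_{A_1} = U_{A_2}\circ(\mathcal{A}/u)$. The canonical transformation $\sigma^u$ is the mate of this equality, i.e. the composite $$L_{A_2}(\mathcal{B}/U(u)) \xrightarrow{L_{A_2}(\mathcal{B}/U(u))(\eta^{A_1})} L_{A_2}(\mathcal{B}/U(u))U_{A_1}L_{A_1} = L_{A_2}U_{A_2}(\mathcal{A}/u)L_{A_1}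 \xrightarrow{\epsilon^{A_2}_{(\mathcal{A}/u)L_{A_1}}} (\mathcal{A}/u)L_{A_1}.$$ *)

theory Defs
  imports Main
begin

record ('o, 'm) cat =
  Obj :: "'o set"
  Arr :: "'m set"
  Dom :: "'m \<Rightarrow> 'o"
  Cod :: "'m \<Rightarrow> 'o"
  Ide :: "'o \<Rightarrow> 'm"
  Comp :: "'m \<Rightarrow> 'm \<Rightarrow> 'm" (infixr "\<cdot>\<index>" 70)

definition Hom :: "('o, 'm, 'z) cat_scheme \<Rightarrow> 'o \<Rightarrow> 'o \<Rightarrow> 'm set" where
  "Hom C X Y = {f \<in> Arr C. Dom C f = X \<and> Cod C f = Y}"

locale category =
  fixes C :: "('o, 'm) cat" (structure)
  assumes dom_obj: "f \<in> Arr C \<Longrightarrow> Dom C f \<in> Obj C"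
    and cod_obj: "f \<in> Arr C \<Longrightarrow> Cod C f \<in> Obj C"
    and ide_hom: "X \<in> Obj C \<Longrightarrow> Ide C X \<in> Hom C X X"
    and comp_hom: "f \<in> Hom C X Y \<Longrightarrow> g \<in> Hom C Y Z \<Longrightarrow> g \<cdot> f \<in> Hom C X Z"
    and ide_left: "f \<in> Hom C X Y \<Longrightarrow> Ide C Y \<cdot> f = f"
    and ide_right: "f \<in> Hom C X Y \<Longrightarrow> f \<cdot> Ide C X = f"
    and assoc: "f \<in> Hom C W X \<Longrightarrow> g \<in> Hom C X Y \<Longrightarrow> h \<in> Hom C Y Z \<Longrightarrow>
      (h \<cdot> g) \<cdot> f = h \<cdot> (g \<cdot> f)"

definition is_iso :: "('o, 'm) cat \<Rightarrow> 'm \<Rightarrow> bool" where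
  "is_iso C f \<longleftrightarrow> f \<in> Arr C \<and>
    (\<exists>g \<in> Hom C (Cod C f) (Dom C f).
      g \<cdot>\<^bsub>C\<^esub> f = Ide C (Dom C f) \<and> f \<cdot>\<^bsub>C\<^esub> g = Ide C (Cod C f))"

record ('o1, 'm1, 'o2, 'm2) func =
  omap :: "'o1 \<Rightarrow> 'o2"
  amap :: "'m1 \<Rightarrow> 'm2"

locale cat_functor = source: category C + target: category D
  for C :: "('o1, 'm1) cat" and D :: "('o2, 'm2) cat" +
  fixes F :: "('o1, 'm1, 'o2, 'm2) func"
  assumes omap_obj: "X \<in> Obj C \<Longrightarrow> omap F X \<in> Obj D"
    and amap_hom: "f \<in> Hom C X Y \<Longrightarrow> amap F f \<in> Hom D (omap F X) (omap F Y)"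
    and amap_ide: "X \<in> Obj C \<Longrightarrow> amap F (Ide C X) = Ide D (omap F X)"
    and amap_comp: "f \<in> Hom C X Y \<Longrightarrow> g \<in> Hom C Y Z \<Longrightarrow>
      amap F (g \<cdot>\<^bsub>C\<^esub> f) = amap F g \<cdot>\<^bsub>D\<^esub> amap F f"

definition id_func :: "('o, 'm, 'o, 'm) func" where
  "id_func = \<lparr>omap = (\<lambda>X. X), amap = (\<lambda>f. f)\<rparr>"

definition comp_func ::
  "('o2, 'm2, 'o3, 'm3) func \<Rightarrow> ('o1, 'm1, 'o2, 'm2) func \<Rightarrow> ('o1, 'm1, 'o3, 'm3) func"
  (infixr "\<circ>\<^sub>F" 75) where
  "G \<circ>\<^sub>F F = \<lparr>omap = omap G \<circ> omap F, amap = amap G \<circ> amap F\<rparr>"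

text \<open>Functors are functions on the ambient types, so two functors out of a category are
  identified when they agree on its objects and arrows.\<close>

definition func_eq ::
  "('o1, 'm1) cat \<Rightarrow> ('o1, 'm1, 'o2, 'm2) func \<Rightarrow> ('o1, 'm1, 'o2, 'm2) func \<Rightarrow> bool" where
  "func_eq C F G \<longleftrightarrow>
    (\<forall>X \<in> Obj C. omap F X = omap G X) \<and> (\<forall>f \<in> Arr C. amap F f = amap G f)"

locale nat_trans = F: cat_functor C D F + G: cat_functor C D G
  for C :: "('o1, 'm1) cat" and D :: "('o2, 'm2) cat"
    and F :: "('o1, 'm1, 'o2, 'm2) func" and G :: "('o1, 'm1, 'o2, 'm2) func" +
  fixes \<tau> :: "'o1 \<Rightarrow> 'm2"
  assumes component: "X \<in> Obj C \<Longrightarrow> \<tau> X \<in> Hom D (omap F X) (omap G X)"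
    and natural: "f \<in> Hom C X Y \<Longrightarrow> \<tau> Y \<cdot>\<^bsub>D\<^esub> amap F f = amap G f \<cdot>\<^bsub>D\<^esub> \<tau> X"

definition vcomp :: "('o2, 'm2) cat \<Rightarrow> ('o1 \<Rightarrow> 'm2) \<Rightarrow> ('o1 \<Rightarrow> 'm2) \<Rightarrow> 'o1 \<Rightarrow> 'm2" where
  "vcomp D \<sigma> \<tau> = (\<lambda>X. \<sigma> X \<cdot>\<^bsub>D\<^esub> \<tau> X)"

definition whisker_left :: "('o2, 'm2, 'o3, 'm3) func \<Rightarrow> ('o1 \<Rightarrow> 'm2) \<Rightarrow> 'o1 \<Rightarrow> 'm3" where
  "whisker_left H \<tau> = (\<lambda>X. amap H (\<tau> X))"

definition whisker_right :: "('o2 \<Rightarrow> 'm3) \<Rightarrow> ('o1, 'm1, 'o2, 'm2) func \<Rightarrow> 'o1 \<Rightarrow> 'm3" where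
  "whisker_right \<tau> F = (\<lambda>X. \<tau> (omap F X))"

text \<open>\<open>adjunction C D L R \<eta> \<epsilon>\<close>: the functor \<open>L\<close> from \<open>D\<close> to \<open>C\<close> is left adjoint to the
  functor \<open>R\<close> from \<open>C\<close> to \<open>D\<close>.\<close>

locale adjunction =
  L: cat_functor D C L + R: cat_functor C D R +
  unit: nat_trans D D id_func "R \<circ>\<^sub>F L" \<eta> + counit: nat_trans C C "L \<circ>\<^sub>F R" id_func \<epsilon>
  for C :: "('o1, 'm1) cat" and D :: "('o2, 'm2) cat"
    and L :: "('o2, 'm2, 'o1, 'm1) func" and R :: "('o1, 'm1, 'o2, 'm2) func"
    and \<eta> :: "'o2 \<Rightarrow> 'm2" and \<epsilon> :: "'o1 \<Rightarrow> 'm1" +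
  assumes triangle_L: "Y \<in> Obj D \<Longrightarrow> \<epsilon> (omap L Y) \<cdot>\<^bsub>C\<^esub> amap L (\<eta> Y) = Ide C (omap L Y)"
    and triangle_R: "X \<in> Obj C \<Longrightarrow> amap R (\<epsilon> X) \<cdot>\<^bsub>D\<^esub> \<eta> (omap R X) = Ide D (omap R X)"

text \<open>An arrow \<open>(f, h, g)\<close> of the slice is the arrow \<open>h\<close> regarded as going from \<open>f\<close> to \<open>g\<close>; the
  two structure arrows are recorded since \<open>h\<close> alone does not determine them.\<close>

definition slice :: "('o, 'm) cat \<Rightarrow> 'o \<Rightarrow> ('m, 'm \<times> 'm \<times> 'm) cat" where
  "slice C X =
    \<lparr>Obj = {f \<in> Arr C. Cod C f = X},
     Arr = {(f, h, g). f \<in> Arr C \<and> Cod C f = X \<and> g \<in> Arr C \<and> Cod C g = X \<and>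
              h \<in> Hom C (Dom C f) (Dom C g) \<and> g \<cdot>\<^bsub>C\<^esub> h = f},
     Dom = (\<lambda>(f, h, g). f),
     Cod = (\<lambda>(f, h, g). g),
     Ide = (\<lambda>f. (f, Ide C (Dom C f), f)),
     Comp = (\<lambda>(f', h', g') (f, h, g). (f, h' \<cdot>\<^bsub>C\<^esub> h, g'))\<rparr>"

text \<open>The action of \<open>U\<close> on slices. The maps do not depend on the object \<open>A\<close> sliced over; only the
  source and target categories do.\<close>

definition slice_func ::
  "('o1, 'm1, 'o2, 'm2) func \<Rightarrow> ('m1, 'm1 \<times> 'm1 \<times> 'm1, 'm2, 'm2 \<times> 'm2 \<times> 'm2) func" where
  "slice_func U =
    \<lparr>omap = amap U, amap = (\<lambda>(f, h, g). (amap U f, amap U h, amap U g))\<rparr>"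

definition slice_post ::
  "('o, 'm) cat \<Rightarrow> 'm \<Rightarrow> ('m, 'm \<times> 'm \<times> 'm, 'm, 'm \<times> 'm \<times> 'm) func" where
  "slice_post C u =
    \<lparr>omap = (\<lambda>f. u \<cdot>\<^bsub>C\<^esub> f), amap = (\<lambda>(f, h, g). (u \<cdot>\<^bsub>C\<^esub> f, h, u \<cdot>\<^bsub>C\<^esub> g))\<rparr>"

definition local_right_adjoint ::
  "('o1, 'm1) cat \<Rightarrow> ('o2, 'm2) cat \<Rightarrow> ('o1, 'm1, 'o2, 'm2) func \<Rightarrow> bool" where
  "local_right_adjoint \<A> \<B> U \<longleftrightarrow> cat_functor \<A> \<B> U \<and>
    (\<forall>A \<in> Obj \<A>. \<exists>L \<eta> \<epsilon>.
      adjunction (slice \<A> A) (slice \<B> (omap U A)) L (slice_func U) \<eta> \<epsilon>)"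

text \<open>The mate at \<open>u\<close>. The two whiskered transformations compose because \<open>slice_post_square\<close> below
  identifies the target of the first with the source of the second.\<close>

definition beck_chevalley_map ::
  "('o1, 'm1) cat \<Rightarrow> ('o2, 'm2) cat \<Rightarrow> ('o1, 'm1, 'o2, 'm2) func \<Rightarrow>
   ('o1 \<Rightarrow> ('m2, 'm2 \<times> 'm2 \<times> 'm2, 'm1, 'm1 \<times> 'm1 \<times> 'm1) func) \<Rightarrow>
   ('o1 \<Rightarrow> 'm2 \<Rightarrow> 'm2 \<times> 'm2 \<times> 'm2) \<Rightarrow> ('o1 \<Rightarrow> 'm1 \<Rightarrow> 'm1 \<times> 'm1 \<times> 'm1) \<Rightarrow>
   'm1 \<Rightarrow> 'm2 \<Rightarrow> 'm1 \<times> 'm1 \<times> 'm1" where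
  "beck_chevalley_map \<A> \<B> U L \<eta> \<epsilon> u =
    (let A\<^sub>1 = Dom \<A> u; A\<^sub>2 = Cod \<A> u in
      vcomp (slice \<A> A\<^sub>2)
        (whisker_right (\<epsilon> A\<^sub>2) (slice_post \<A> u \<circ>\<^sub>F L A\<^sub>1))
        (whisker_left (L A\<^sub>2 \<circ>\<^sub>F slice_post \<B> (amap U u)) (\<eta> A\<^sub>1)))"

lemma (in category) category_slice:
  assumes "X \<in> Obj C"
  shows "category (slice C X)"
proof
  fix f assume "f \<in> Obj (slice C X)"
  then show "Ide (slice C X) f \<in> Hom (slice C X) f f"
    using ide_hom[OF dom_obj, of f] ide_right[of f "Dom C f" X]
    by (auto simp: slice_def Hom_def)
next
  fix f g h p q assume "p \<in> Hom (slice C X) f g" "q \<in> Hom (slice C X) g h"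
  then obtain p' q' where "p = (f, p', g)" "q = (g, q', h)"
    and "f \<in> Hom C (Dom C f) X" "h \<in> Hom C (Dom C h) X"
    and p': "p' \<in> Hom C (Dom C f) (Dom C g)" "g \<cdot> p' = f"
    and q': "q' \<in> Hom C (Dom C g) (Dom C h)" "h \<cdot> q' = g"
    by (auto simp: slice_def Hom_def)
  moreover have "h \<cdot> (q' \<cdot> p') = f"
    using assoc[OF p'(1) q'(1) \<open>h \<in> Hom C (Dom C h) X\<close>] p' q' by simp
  ultimately show "q \<cdot>\<^bsub>slice C X\<^esub> p \<in> Hom (slice C X) f h"
    using comp_hom[OF p'(1) q'(1)] by (auto simp: slice_def Hom_def)
qed (auto simp: slice_def Hom_def intro: ide_left[unfolded Hom_def] ide_right[unfolded Hom_def]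
    assoc[unfolded Hom_def])

lemma (in category) cat_functor_slice_post:
  assumes u: "u \<in> Hom C X Y"
  shows "cat_functor (slice C X) (slice C Y) (slice_post C u)"
proof -
  have X: "X \<in> Obj C" and Y: "Y \<in> Obj C"
    using u dom_obj cod_obj by (auto simp: Hom_def)
  interpret CX: category "slice C X" using X by (rule category_slice)
  interpret CY: category "slice C Y" using Y by (rule category_slice)
  have post: "u \<cdot> f \<in> Arr C" "Dom C (u \<cdot> f) = Dom C f" "Cod C (u \<cdot> f) = Y"
    if "f \<in> Arr C" "Cod C f = X" for f
    using comp_hom[OF _ u, of f] that by (auto simp: Hom_def)
  have "(u \<cdot> g) \<cdot> h = u \<cdot> (g \<cdot> h)"
    if "g \<in> Arr C" "Cod C g = X" "h \<in> Hom C W (Dom C g)" for g h W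
    using assoc[OF that(3) _ u] that by (auto simp: Hom_def)
  with post show ?thesis
    by unfold_locales (auto simp: slice_def slice_post_def Hom_def)
qed

lemma (in cat_functor) cat_functor_slice_func:
  assumes X: "X \<in> Obj C"
  shows "cat_functor (slice C X) (slice D (omap F X)) (slice_func F)"
proof -
  interpret CX: category "slice C X" using X by (rule source.category_slice)
  interpret DX: category "slice D (omap F X)"
    using omap_obj[OF X] by (rule target.category_slice)
  have im: "amap F f \<in> Arr D" "Dom D (amap F f) = omap F (Dom C f)"
    "Cod D (amap F f) = omap F (Cod C f)" if "f \<in> Arr C" for f
    using amap_hom[of f] that by (auto simp: Hom_def)
  have "amap F g \<cdot>\<^bsub>D\<^esub> amap F h = amap F (g \<cdot>\<^bsub>C\<^esub> h)"
    if "g \<in> Arr C" "h \<in> Arr C" "Cod C h = Dom C g" for g h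
    using amap_comp[of h _ _ g] that by (auto simp: Hom_def)
  with im show ?thesis
    by unfold_locales
      (auto simp: slice_def slice_func_def Hom_def source.dom_obj amap_ide)
qed

lemma (in cat_functor) slice_post_square:
  assumes "u \<in> Hom C X Y"
  shows "func_eq (slice C X)
    (slice_post D (amap F u) \<circ>\<^sub>F slice_func F) (slice_func F \<circ>\<^sub>F slice_post C u)"
  using assms amap_comp[of _ _ X u Y]
  by (auto simp: func_eq_def slice_def slice_func_def slice_post_def comp_func_def Hom_def)

end

theory Submission
  imports Defs
begin

text \<open>Write \<open>l = L A\<^sub>1 x\<close> with unit \<open>n\<close>, \<open>l' = L A\<^sub>2 (U u \<cdot> x)\<close> with unit \<open>n'\<close>, and let \<open>s\<close> be the
  arrow underlying the mate at \<open>x\<close>, so that \<open>u \<cdot> l \<cdot> s = l'\<close> and \<open>U s \<cdot> n' = n\<close>. The arrow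
  \<open>l \<cdot> s\<close> regards the domain of \<open>l'\<close> as an object over \<open>A\<^sub>1\<close>, and \<open>n'\<close> is a morphism from \<open>x\<close> to
  \<open>U (l \<cdot> s)\<close> over \<open>U A\<^sub>1\<close>; its transpose \<open>t\<close> satisfies \<open>U t \<cdot> n = n'\<close>. Then \<open>s \<cdot> t\<close> fixes \<open>n\<close> over
  \<open>A\<^sub>1\<close> and \<open>t \<cdot> s\<close> fixes \<open>n'\<close> over \<open>A\<^sub>2\<close>, so both are identities by uniqueness of transposes.\<close>

lemma (in category) in_HomD:
  assumes "f \<in> Hom C X Y"
  shows "X \<in> Obj C" "Y \<in> Obj C"
  using assms dom_obj cod_obj by (auto simp: Hom_def)

lemma cat_functor_comp:
  assumes "cat_functor C D F" "cat_functor D E G"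
  shows "cat_functor C E (G \<circ>\<^sub>F F)"
proof -
  interpret F: cat_functor C D F by fact
  interpret G: cat_functor D E G by fact
  show ?thesis
  proof unfold_locales
    fix f g X Y Z assume f: "f \<in> Hom C X Y" and g: "g \<in> Hom C Y Z"
    show "amap (G \<circ>\<^sub>F F) (g \<cdot>\<^bsub>C\<^esub> f) = amap (G \<circ>\<^sub>F F) g \<cdot>\<^bsub>E\<^esub> amap (G \<circ>\<^sub>F F) f"
      by (simp add: comp_func_def F.amap_comp[OF f g] G.amap_comp[OF F.amap_hom[OF f] F.amap_hom[OF g]])
  qed (simp_all add: comp_func_def F.omap_obj G.omap_obj F.amap_ide G.amap_ide F.amap_hom G.amap_hom)
qed

section \<open>Transposition across an adjunction and uniqueness of transposes\<close>

context adjunction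
begin

lemma unit_hom: "Y \<in> Obj D \<Longrightarrow> \<eta> Y \<in> Hom D Y (omap R (omap L Y))"
  using unit.component[of Y] by (simp add: id_func_def comp_func_def)

lemma counit_hom: "X \<in> Obj C \<Longrightarrow> \<epsilon> X \<in> Hom C (omap L (omap R X)) X"
  using counit.component[of X] by (simp add: id_func_def comp_func_def)

lemma unit_natural: "f \<in> Hom D X Y \<Longrightarrow> \<eta> Y \<cdot>\<^bsub>D\<^esub> f = amap R (amap L f) \<cdot>\<^bsub>D\<^esub> \<eta> X"
  using unit.natural[of f X Y] by (simp add: id_func_def comp_func_def)

lemma counit_natural: "f \<in> Hom C X Y \<Longrightarrow> \<epsilon> Y \<cdot>\<^bsub>C\<^esub> amap L (amap R f) = f \<cdot>\<^bsub>C\<^esub> \<epsilon> X"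
  using counit.natural[of f X Y] by (simp add: id_func_def comp_func_def)

lemma transpose_hom:
  assumes "X \<in> Obj C" "g \<in> Hom D Y (omap R X)"
  shows "\<epsilon> X \<cdot>\<^bsub>C\<^esub> amap L g \<in> Hom C (omap L Y) X"
  using L.amap_hom[OF assms(2)] counit_hom[OF assms(1)] by (rule L.target.comp_hom)

text \<open>Naturality of the unit moves \<open>g\<close> to the right of
  \<open>\<eta> (omap R X)\<close>, where \<open>triangle_R\<close> cancels what precedes
  it.\<close>

lemma transpose_unit:
  assumes X: "X \<in> Obj C" and g: "g \<in> Hom D Y (omap R X)"
  shows "amap R (\<epsilon> X \<cdot>\<^bsub>C\<^esub> amap L g) \<cdot>\<^bsub>D\<^esub> \<eta> Y = g"
proof -
  note Lg = L.amap_hom[OF g] and e = counit_hom[OF X]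
    and Y = L.source.in_HomD[OF g]
  have "amap R (\<epsilon> X \<cdot>\<^bsub>C\<^esub> amap L g) \<cdot>\<^bsub>D\<^esub> \<eta> Y
      = amap R (\<epsilon> X) \<cdot>\<^bsub>D\<^esub> (amap R (amap L g) \<cdot>\<^bsub>D\<^esub> \<eta> Y)"
    by (simp add: R.amap_comp[OF Lg e]
        L.source.assoc[OF unit_hom[OF Y(1)] R.amap_hom[OF Lg] R.amap_hom[OF e]])
  also have "\<dots> = (amap R (\<epsilon> X) \<cdot>\<^bsub>D\<^esub> \<eta> (omap R X)) \<cdot>\<^bsub>D\<^esub> g"
    by (simp add: unit_natural[OF g]
        L.source.assoc[OF g unit_hom[OF Y(2)] R.amap_hom[OF e]])
  also have "\<dots> = g"
    by (simp add: triangle_R[OF X] L.source.ide_left[OF g])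
  finally show ?thesis .
qed

text \<open>Dual argument: naturality of the counit moves \<open>f\<close> to the left, and
  \<open>triangle_L\<close> cancels the rest. This yields uniqueness of transposes, since
  \<open>f\<close> is recovered from its composite with the unit.\<close>

lemma transpose_transpose:
  assumes f: "f \<in> Hom C (omap L Y) X" and Y: "Y \<in> Obj D"
  shows "\<epsilon> X \<cdot>\<^bsub>C\<^esub> amap L (amap R f \<cdot>\<^bsub>D\<^esub> \<eta> Y) = f"
proof -
  note Rf = R.amap_hom[OF f] and n = unit_hom[OF Y]
    and X = L.target.in_HomD[OF f]
  have "\<epsilon> X \<cdot>\<^bsub>C\<^esub> amap L (amap R f \<cdot>\<^bsub>D\<^esub> \<eta> Y)
      = (\<epsilon> X \<cdot>\<^bsub>C\<^esub> amap L (amap R f)) \<cdot>\<^bsub>C\<^esub> amap L (\<eta> Y)"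
    by (simp add: L.amap_comp[OF n Rf]
        L.target.assoc[OF L.amap_hom[OF n] L.amap_hom[OF Rf] counit_hom[OF X(2)]])
  also have "\<dots> = f \<cdot>\<^bsub>C\<^esub> (\<epsilon> (omap L Y) \<cdot>\<^bsub>C\<^esub> amap L (\<eta> Y))"
    by (simp add: counit_natural[OF f]
        L.target.assoc[OF L.amap_hom[OF n] counit_hom[OF X(1)] f])
  also have "\<dots> = f"
    by (simp add: triangle_L[OF Y] L.target.ide_right[OF f])
  finally show ?thesis .
qed

lemma transpose_unique:
  assumes "Y \<in> Obj D" "f \<in> Hom C (omap L Y) X" "g \<in> Hom C (omap L Y) X"
    and "amap R f \<cdot>\<^bsub>D\<^esub> \<eta> Y = amap R g \<cdot>\<^bsub>D\<^esub> \<eta> Y"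
  shows "f = g"
  using transpose_transpose[OF assms(2,1)] transpose_transpose[OF assms(3,1)]
  unfolding assms(4) by (rule trans[OF sym])

text \<open>The identity fixes the unit too, so uniqueness applies. Both inverse laws for the mate
  come from this criterion.\<close>

lemma eq_ide_if_fixes_unit:
  assumes Y: "Y \<in> Obj D" and f: "f \<in> Hom C (omap L Y) (omap L Y)"
    and fix_unit: "amap R f \<cdot>\<^bsub>D\<^esub> \<eta> Y = \<eta> Y"
  shows "f = Ide C (omap L Y)"
proof (rule transpose_unique[OF Y f])
  show "Ide C (omap L Y) \<in> Hom C (omap L Y) (omap L Y)"
    using L.omap_obj[OF Y] by (rule L.target.ide_hom)
  show "amap R f \<cdot>\<^bsub>D\<^esub> \<eta> Y = amap R (Ide C (omap L Y)) \<cdot>\<^bsub>D\<^esub> \<eta> Y"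
    by (simp add: fix_unit R.amap_ide[OF L.omap_obj[OF Y]] L.source.ide_left[OF unit_hom[OF Y]])
qed

end

section \<open>Mates of a square of right adjoints\<close>

locale adjunction_square =
  adj1: adjunction C\<^sub>1 D\<^sub>1 L\<^sub>1 R\<^sub>1 \<eta>\<^sub>1 \<epsilon>\<^sub>1 + adj2: adjunction C\<^sub>2 D\<^sub>2 L\<^sub>2 R\<^sub>2 \<eta>\<^sub>2 \<epsilon>\<^sub>2 +
  P: cat_functor C\<^sub>1 C\<^sub>2 P + Q: cat_functor D\<^sub>1 D\<^sub>2 Q
  for C\<^sub>1 :: "('a, 'b) cat" and D\<^sub>1 :: "('c, 'd) cat" and L\<^sub>1 R\<^sub>1 \<eta>\<^sub>1 \<epsilon>\<^sub>1
    and C\<^sub>2 :: "('e, 'f) cat" and D\<^sub>2 :: "('g, 'h) cat" and L\<^sub>2 R\<^sub>2 \<eta>\<^sub>2 \<epsilon>\<^sub>2 P Q +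
  assumes square: "func_eq C\<^sub>1 (Q \<circ>\<^sub>F R\<^sub>1) (R\<^sub>2 \<circ>\<^sub>F P)"
begin

text \<open>The formula copies the shape of \<open>beck_chevalley_map\<close> for arbitrary
  adjunctions, so typing and naturality can be proved without the triples of the slices.\<close>

definition mate :: "'c \<Rightarrow> 'f" where
  "mate = vcomp C\<^sub>2 (whisker_right \<epsilon>\<^sub>2 (P \<circ>\<^sub>F L\<^sub>1)) (whisker_left (L\<^sub>2 \<circ>\<^sub>F Q) \<eta>\<^sub>1)"

lemma mate_eq: "mate Y = \<epsilon>\<^sub>2 (omap P (omap L\<^sub>1 Y)) \<cdot>\<^bsub>C\<^sub>2\<^esub> amap L\<^sub>2 (amap Q (\<eta>\<^sub>1 Y))"
  by (simp add: mate_def vcomp_def whisker_right_def whisker_left_def comp_func_def)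

lemma square_omap: "X \<in> Obj C\<^sub>1 \<Longrightarrow> omap Q (omap R\<^sub>1 X) = omap R\<^sub>2 (omap P X)"
  using square by (simp add: func_eq_def comp_func_def)

lemma square_amap: "f \<in> Hom C\<^sub>1 X Y \<Longrightarrow> amap Q (amap R\<^sub>1 f) = amap R\<^sub>2 (amap P f)"
  using square by (simp add: func_eq_def comp_func_def Hom_def)

text \<open>The square rewrites the codomain \<open>Q R\<^sub>1 L\<^sub>1 Y\<close> as
  \<open>R\<^sub>2 P L\<^sub>1 Y\<close>, which makes this arrow transposable along the second
  adjunction.\<close>

lemma image_unit_hom:
  assumes "Y \<in> Obj D\<^sub>1"
  shows "amap Q (\<eta>\<^sub>1 Y) \<in> Hom D\<^sub>2 (omap Q Y) (omap R\<^sub>2 (omap P (omap L\<^sub>1 Y)))"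
  using Q.amap_hom[OF adj1.unit_hom[OF assms]] square_omap[OF adj1.L.omap_obj[OF assms]] by simp

lemma mate_hom:
  assumes "Y \<in> Obj D\<^sub>1"
  shows "mate Y \<in> Hom C\<^sub>2 (omap L\<^sub>2 (omap Q Y)) (omap P (omap L\<^sub>1 Y))"
  unfolding mate_eq using assms
  by (intro adj2.transpose_hom image_unit_hom P.omap_obj adj1.L.omap_obj)

text \<open>The mate is by construction the transpose of \<open>amap Q (\<eta>\<^sub>1 Y)\<close>.
  Besides its typing, this is all that the proof of invertibility uses about it.\<close>

lemma mate_unit:
  assumes "Y \<in> Obj D\<^sub>1"
  shows "amap R\<^sub>2 (mate Y) \<cdot>\<^bsub>D\<^sub>2\<^esub> \<eta>\<^sub>2 (omap Q Y) = amap Q (\<eta>\<^sub>1 Y)"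
  unfolding mate_eq using assms
  by (intro adj2.transpose_unit image_unit_hom P.omap_obj adj1.L.omap_obj)

lemma mate_natural:
  assumes f: "f \<in> Hom D\<^sub>1 X Y"
  shows "mate Y \<cdot>\<^bsub>C\<^sub>2\<^esub> amap L\<^sub>2 (amap Q f) = amap P (amap L\<^sub>1 f) \<cdot>\<^bsub>C\<^sub>2\<^esub> mate X"
proof -
  note XY = adj1.L.source.in_HomD[OF f]
  note Lf = adj1.L.amap_hom[OF f] and Qf = Q.amap_hom[OF f]
  note PLf = P.amap_hom[OF Lf]
  note RPLf = adj2.R.amap_hom[OF PLf]
  note nX = image_unit_hom[OF XY(1)] and nY = image_unit_hom[OF XY(2)]
  note eX = adj2.counit_hom[OF P.omap_obj[OF adj1.L.omap_obj[OF XY(1)]]]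
    and eY = adj2.counit_hom[OF P.omap_obj[OF adj1.L.omap_obj[OF XY(2)]]]
  \<comment> \<open>Naturality of \<open>\<eta>\<^sub>1\<close> under \<open>Q\<close>, with
    \<open>Q R\<^sub>1\<close> then traded for \<open>R\<^sub>2 P\<close> by the square.\<close>
  have image: "amap Q (\<eta>\<^sub>1 Y) \<cdot>\<^bsub>D\<^sub>2\<^esub> amap Q f = amap R\<^sub>2 (amap P (amap L\<^sub>1 f)) \<cdot>\<^bsub>D\<^sub>2\<^esub> amap Q (\<eta>\<^sub>1 X)"
    using Q.amap_comp[OF f adj1.unit_hom[OF XY(2)]]
      Q.amap_comp[OF adj1.unit_hom[OF XY(1)] adj1.R.amap_hom[OF Lf]]
    by (simp add: adj1.unit_natural[OF f] square_amap[OF Lf])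
  have "mate Y \<cdot>\<^bsub>C\<^sub>2\<^esub> amap L\<^sub>2 (amap Q f)
      = \<epsilon>\<^sub>2 (omap P (omap L\<^sub>1 Y)) \<cdot>\<^bsub>C\<^sub>2\<^esub> amap L\<^sub>2 (amap Q (\<eta>\<^sub>1 Y) \<cdot>\<^bsub>D\<^sub>2\<^esub> amap Q f)"
    by (simp add: mate_eq adj2.L.amap_comp[OF Qf nY]
        adj2.L.target.assoc[OF adj2.L.amap_hom[OF Qf] adj2.L.amap_hom[OF nY] eY])
  also have "\<dots> = (\<epsilon>\<^sub>2 (omap P (omap L\<^sub>1 Y)) \<cdot>\<^bsub>C\<^sub>2\<^esub> amap L\<^sub>2 (amap R\<^sub>2 (amap P (amap L\<^sub>1 f))))
      \<cdot>\<^bsub>C\<^sub>2\<^esub> amap L\<^sub>2 (amap Q (\<eta>\<^sub>1 X))"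
    by (simp add: image adj2.L.amap_comp[OF nX RPLf]
        adj2.L.target.assoc[OF adj2.L.amap_hom[OF nX] adj2.L.amap_hom[OF RPLf] eY])
  also have "\<dots> = amap P (amap L\<^sub>1 f) \<cdot>\<^bsub>C\<^sub>2\<^esub> mate X"
    by (simp add: mate_eq adj2.counit_natural[OF PLf]
        adj2.L.target.assoc[OF adj2.L.amap_hom[OF nX] eX PLf])
  finally show ?thesis .
qed

lemma nat_trans_mate: "nat_trans D\<^sub>1 C\<^sub>2 (L\<^sub>2 \<circ>\<^sub>F Q) (P \<circ>\<^sub>F L\<^sub>1) mate"
proof (rule nat_trans.intro)
  show "cat_functor D\<^sub>1 C\<^sub>2 (L\<^sub>2 \<circ>\<^sub>F Q)"
    by (rule cat_functor_comp) (rule Q.cat_functor_axioms adj2.L.cat_functor_axioms)+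
  show "cat_functor D\<^sub>1 C\<^sub>2 (P \<circ>\<^sub>F L\<^sub>1)"
    by (rule cat_functor_comp) (rule P.cat_functor_axioms adj1.L.cat_functor_axioms)+
  show "nat_trans_axioms D\<^sub>1 C\<^sub>2 (L\<^sub>2 \<circ>\<^sub>F Q) (P \<circ>\<^sub>F L\<^sub>1) mate"
    by unfold_locales (simp_all add: comp_func_def mate_hom mate_natural)
qed

end

section \<open>Slices in terms of underlying arrows\<close>

lemma Obj_slice: "f \<in> Obj (slice C X) \<longleftrightarrow> f \<in> Hom C (Dom C f) X"
  by (auto simp: slice_def Hom_def)

lemma Hom_slice:
  "p \<in> Hom (slice C X) f g \<longleftrightarrow> (\<exists>h. p = (f, h, g) \<and> f \<in> Hom C (Dom C f) X \<and>
    g \<in> Hom C (Dom C g) X \<and> h \<in> Hom C (Dom C f) (Dom C g) \<and> g \<cdot>\<^bsub>C\<^esub> h = f)"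
  by (auto simp: slice_def Hom_def)

lemma Comp_slice: "(f', h', g') \<cdot>\<^bsub>slice C X\<^esub> (f, h, g) = (f, h' \<cdot>\<^bsub>C\<^esub> h, g')"
  by (simp add: slice_def)

lemma Ide_slice: "Ide (slice C X) f = (f, Ide C (Dom C f), f)"
  by (simp add: slice_def)

lemma amap_slice_func: "amap (slice_func F) (f, h, g) = (amap F f, amap F h, amap F g)"
  by (simp add: slice_func_def)

lemma omap_slice_func: "omap (slice_func F) f = amap F f"
  by (simp add: slice_func_def)

lemma omap_slice_post: "omap (slice_post C u) f = u \<cdot>\<^bsub>C\<^esub> f"
  by (simp add: slice_post_def)

lemma amap_slice_post: "amap (slice_post C u) (f, h, g) = (u \<cdot>\<^bsub>C\<^esub> f, h, u \<cdot>\<^bsub>C\<^esub> g)"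
  by (simp add: slice_post_def)

lemma is_isoI:
  assumes "f \<in> Hom C X Y" "g \<in> Hom C Y X" "g \<cdot>\<^bsub>C\<^esub> f = Ide C X" "f \<cdot>\<^bsub>C\<^esub> g = Ide C Y"
  shows "is_iso C f"
  using assms by (auto simp: is_iso_def Hom_def)

section \<open>Inverting the mate over slices\<close>

theorem theorem1p2:
  fixes \<A> :: "('o1, 'm1) cat" and \<B> :: "('o2, 'm2) cat"
    and U :: "('o1, 'm1, 'o2, 'm2) func"
    and L :: "'o1 \<Rightarrow> ('m2, 'm2 \<times> 'm2 \<times> 'm2, 'm1, 'm1 \<times> 'm1 \<times> 'm1) func"
    and \<eta> :: "'o1 \<Rightarrow> 'm2 \<Rightarrow> 'm2 \<times> 'm2 \<times> 'm2"
    and \<epsilon> :: "'o1 \<Rightarrow> 'm1 \<Rightarrow> 'm1 \<times> 'm1 \<times> 'm1"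
    and A\<^sub>1 A\<^sub>2 :: 'o1 and u :: 'm1
  assumes "local_right_adjoint \<A> \<B> U"
    and "\<And>A. A \<in> Obj \<A> \<Longrightarrow>
      adjunction (slice \<A> A) (slice \<B> (omap U A)) (L A) (slice_func U) (\<eta> A) (\<epsilon> A)"
    and "u \<in> Hom \<A> A\<^sub>1 A\<^sub>2"
  shows "nat_trans (slice \<B> (omap U A\<^sub>1)) (slice \<A> A\<^sub>2)
      (L A\<^sub>2 \<circ>\<^sub>F slice_post \<B> (amap U u)) (slice_post \<A> u \<circ>\<^sub>F L A\<^sub>1)
      (beck_chevalley_map \<A> \<B> U L \<eta> \<epsilon> u) \<and>
    (\<forall>X \<in> Obj (slice \<B> (omap U A\<^sub>1)).
      is_iso (slice \<A> A\<^sub>2) (beck_chevalley_map \<A> \<B> U L \<eta> \<epsilon> u X))"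
proof -
  interpret U: cat_functor \<A> \<B> U
    using assms(1) by (simp add: local_right_adjoint_def)
  note u = assms(3)
  note A = U.source.in_HomD[OF u]
  \<comment> \<open>\<open>slice_func U\<close> serves as both right adjoints, because its maps do
    not depend on the object sliced over.\<close>
  interpret S: adjunction_square
    "slice \<A> A\<^sub>1" "slice \<B> (omap U A\<^sub>1)" "L A\<^sub>1" "slice_func U" "\<eta> A\<^sub>1" "\<epsilon> A\<^sub>1"
    "slice \<A> A\<^sub>2" "slice \<B> (omap U A\<^sub>2)" "L A\<^sub>2" "slice_func U" "\<eta> A\<^sub>2" "\<epsilon> A\<^sub>2"
    "slice_post \<A> u" "slice_post \<B> (amap U u)"
    by (intro adjunction_square.intro adjunction_square_axioms.intro assms(2) A
        U.source.cat_functor_slice_post[OF u] U.slice_post_square[OF u]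
        U.target.cat_functor_slice_post[OF U.amap_hom[OF u]])
  have mate: "beck_chevalley_map \<A> \<B> U L \<eta> \<epsilon> u = S.mate"
    using u by (simp add: beck_chevalley_map_def S.mate_def Hom_def)
  have "is_iso (slice \<A> A\<^sub>2) (S.mate x)" if x: "x \<in> Obj (slice \<B> (omap U A\<^sub>1))" for x
  proof -
    define l where "l = omap (L A\<^sub>1) x"
    define x' where "x' = amap U u \<cdot>\<^bsub>\<B>\<^esub> x"
    define l' where "l' = omap (L A\<^sub>2) x'"
    have x': "x' \<in> Obj (slice \<B> (omap U A\<^sub>2))"
      using S.Q.omap_obj[OF x] by (simp add: omap_slice_post x'_def)
    have "\<eta> A\<^sub>1 x \<in> Hom (slice \<B> (omap U A\<^sub>1)) x (amap U l)"
      using S.adj1.unit_hom[OF x] by (simp add: omap_slice_func l_def)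
    then obtain n where n_eq: "\<eta> A\<^sub>1 x = (x, n, amap U l)"
      and n: "n \<in> Hom \<B> (Dom \<B> x) (Dom \<B> (amap U l))" "amap U l \<cdot>\<^bsub>\<B>\<^esub> n = x"
      by (auto simp: Hom_slice)
    have "\<eta> A\<^sub>2 x' \<in> Hom (slice \<B> (omap U A\<^sub>2)) x' (amap U l')"
      using S.adj2.unit_hom[OF x'] by (simp add: omap_slice_func l'_def)
    then obtain n' where n'_eq: "\<eta> A\<^sub>2 x' = (x', n', amap U l')"
      and n': "n' \<in> Hom \<B> (Dom \<B> x') (Dom \<B> (amap U l'))"
      by (auto simp: Hom_slice)
    have mate_hom: "S.mate x \<in> Hom (slice \<A> A\<^sub>2) l' (u \<cdot>\<^bsub>\<A>\<^esub> l)"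
      using S.mate_hom[OF x] by (simp add: omap_slice_post l_def l'_def x'_def)
    have l: "l \<in> Hom \<A> (Dom \<A> l) A\<^sub>1"
      using S.adj1.L.omap_obj[OF x] by (simp add: Obj_slice l_def)
    have l': "l' \<in> Hom \<A> (Dom \<A> l') A\<^sub>2"
      using S.adj2.L.omap_obj[OF x'] by (simp add: Obj_slice l'_def)
    have ul: "u \<cdot>\<^bsub>\<A>\<^esub> l \<in> Hom \<A> (Dom \<A> l) A\<^sub>2"
      using l u by (rule U.source.comp_hom)
    have dom_ul: "Dom \<A> (u \<cdot>\<^bsub>\<A>\<^esub> l) = Dom \<A> l"
      using ul by (simp add: Hom_def)
    have dom_x': "Dom \<B> x' = Dom \<B> x"
      using U.target.comp_hom[OF x[unfolded Obj_slice] U.amap_hom[OF u]]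
      by (simp add: x'_def Hom_def)
    have dom_Ul: "Dom \<B> (amap U l) = omap U (Dom \<A> l)"
      using U.amap_hom[OF l] by (simp add: Hom_def)
    have dom_Ul': "Dom \<B> (amap U l') = omap U (Dom \<A> l')"
      using U.amap_hom[OF l'] by (simp add: Hom_def)
    \<comment> \<open>Codomains become values of \<open>omap U\<close>, so that \<open>n\<close> and
      \<open>n'\<close> compose with images of arrows of \<open>\<A>\<close>.\<close>
    note n = n[unfolded dom_Ul] and n' = n'[unfolded dom_Ul' dom_x']
    from mate_hom obtain s where s_eq: "S.mate x = (l', s, u \<cdot>\<^bsub>\<A>\<^esub> l)"
      and s: "s \<in> Hom \<A> (Dom \<A> l') (Dom \<A> l)" and uls: "(u \<cdot>\<^bsub>\<A>\<^esub> l) \<cdot>\<^bsub>\<A>\<^esub> s = l'"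
      by (auto simp: Hom_slice dom_ul)
    \<comment> \<open>This is the middle component of \<open>mate_unit\<close>.\<close>
    have Us: "amap U s \<cdot>\<^bsub>\<B>\<^esub> n' = n"
      using S.mate_unit[OF x] n'_eq
      by (simp add: s_eq n_eq omap_slice_post amap_slice_post amap_slice_func Comp_slice flip: x'_def)

    define k where "k = l \<cdot>\<^bsub>\<A>\<^esub> s"
    have k: "k \<in> Hom \<A> (Dom \<A> l') A\<^sub>1"
      unfolding k_def using s l by (rule U.source.comp_hom)
    have dom_k: "Dom \<A> k = Dom \<A> l'"
      using k by (simp add: Hom_def)
    have dom_Uk: "Dom \<B> (amap U k) = omap U (Dom \<A> l')"
      using U.amap_hom[OF k] by (simp add: Hom_def)
    have k_obj: "k \<in> Obj (slice \<A> A\<^sub>1)"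
      using k by (simp add: Obj_slice dom_k)
    \<comment> \<open>\<open>U (l \<cdot> s) \<cdot> n' = U l \<cdot> n = x\<close>: exactly what
      makes \<open>n'\<close> an arrow over \<open>U A\<^sub>1\<close>.\<close>
    have Uk: "amap U k \<cdot>\<^bsub>\<B>\<^esub> n' = x"
      by (simp add: k_def U.amap_comp[OF s l] Us n(2)
          U.target.assoc[OF n' U.amap_hom[OF s] U.amap_hom[OF l]])
    have g: "(x, n', amap U k) \<in> Hom (slice \<B> (omap U A\<^sub>1)) x (omap (slice_func U) k)"
      using x n' Uk U.amap_hom[OF k] by (simp add: Hom_slice Obj_slice omap_slice_func dom_Uk)
    define T where "T = \<epsilon> A\<^sub>1 k \<cdot>\<^bsub>slice \<A> A\<^sub>1\<^esub> amap (L A\<^sub>1) (x, n', amap U k)"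
    have "T \<in> Hom (slice \<A> A\<^sub>1) l k"
      unfolding T_def l_def using k_obj g by (rule S.adj1.transpose_hom)
    then obtain t where T_eq: "T = (l, t, k)"
      and t: "t \<in> Hom \<A> (Dom \<A> l) (Dom \<A> l')" and kt: "k \<cdot>\<^bsub>\<A>\<^esub> t = l"
      by (auto simp: Hom_slice dom_k)
    have Ut: "amap U t \<cdot>\<^bsub>\<B>\<^esub> n = n'"
      using S.adj1.transpose_unit[OF k_obj g, folded T_def]
      by (simp add: T_eq n_eq amap_slice_func Comp_slice)

    have st: "s \<cdot>\<^bsub>\<A>\<^esub> t \<in> Hom \<A> (Dom \<A> l) (Dom \<A> l)" and ts: "t \<cdot>\<^bsub>\<A>\<^esub> s \<in> Hom \<A> (Dom \<A> l') (Dom \<A> l')"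
      using s t by (auto intro: U.source.comp_hom)
    have uk: "u \<cdot>\<^bsub>\<A>\<^esub> k = l'"
      using uls by (simp add: k_def U.source.assoc[OF s l u])
    \<comment> \<open>The arrow \<open>t\<close> was built over \<open>A\<^sub>1\<close>; since
      \<open>u \<cdot> k = l'\<close>, composing \<open>kt\<close> with \<open>u\<close> makes it an
      arrow from \<open>u \<cdot> l\<close> to \<open>l'\<close> over \<open>A\<^sub>2\<close>, the
      candidate inverse.\<close>
    have l't: "l' \<cdot>\<^bsub>\<A>\<^esub> t = u \<cdot>\<^bsub>\<A>\<^esub> l"
      using U.source.assoc[OF t k u] by (simp add: uk kt)
    have lst: "l \<cdot>\<^bsub>\<A>\<^esub> (s \<cdot>\<^bsub>\<A>\<^esub> t) = l"
      using U.source.assoc[OF t s l] by (simp add: kt flip: k_def)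
    have l'ts: "l' \<cdot>\<^bsub>\<A>\<^esub> (t \<cdot>\<^bsub>\<A>\<^esub> s) = l'"
      using U.source.assoc[OF s t l'] by (simp add: l't uls)
    have Ust: "amap U (s \<cdot>\<^bsub>\<A>\<^esub> t) \<cdot>\<^bsub>\<B>\<^esub> n = n"
      by (simp add: U.amap_comp[OF t s] U.target.assoc[OF n(1) U.amap_hom[OF t] U.amap_hom[OF s]] Ut Us)
    have Uts: "amap U (t \<cdot>\<^bsub>\<A>\<^esub> s) \<cdot>\<^bsub>\<B>\<^esub> n' = n'"
      by (simp add: U.amap_comp[OF s t] U.target.assoc[OF n' U.amap_hom[OF s] U.amap_hom[OF t]] Ut Us)
    \<comment> \<open>Uniqueness gives the identity on \<open>l\<close> over
      \<open>A\<^sub>1\<close>, but the inverse law concerns \<open>u \<cdot> l\<close> over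
      \<open>A\<^sub>2\<close>. Both objects have the same domain, so the equation is passed on
      through the underlying arrows.\<close>
    have "(l, s \<cdot>\<^bsub>\<A>\<^esub> t, l) = Ide (slice \<A> A\<^sub>1) l"
      unfolding l_def
      by (rule S.adj1.eq_ide_if_fixes_unit[OF x], fold l_def)
        (use l st lst in \<open>auto simp: Hom_slice n_eq amap_slice_func Comp_slice Ust\<close>)
    then have st_ide: "s \<cdot>\<^bsub>\<A>\<^esub> t = Ide \<A> (Dom \<A> l)"
      by (simp add: Ide_slice)
    \<comment> \<open>Here the second adjunction is the right one: \<open>l'\<close> is the value of
      \<open>L A\<^sub>2\<close>, and the inverse law is already about \<open>l'\<close> over
      \<open>A\<^sub>2\<close>.\<close>
    have ts_ide: "(l', t \<cdot>\<^bsub>\<A>\<^esub> s, l') = Ide (slice \<A> A\<^sub>2) l'"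
      unfolding l'_def
      by (rule S.adj2.eq_ide_if_fixes_unit[OF x'], fold l'_def)
        (use l' ts l'ts in \<open>auto simp: Hom_slice n'_eq amap_slice_func Comp_slice Uts\<close>)
    show ?thesis
    proof (rule is_isoI[OF mate_hom])
      show "(u \<cdot>\<^bsub>\<A>\<^esub> l, t, l') \<in> Hom (slice \<A> A\<^sub>2) (u \<cdot>\<^bsub>\<A>\<^esub> l) l'"
        using ul l' t l't by (simp add: Hom_slice dom_ul)
    qed (simp_all add: s_eq Comp_slice ts_ide st_ide Ide_slice dom_ul)
  qed
  then show ?thesis
    using S.nat_trans_mate by (simp add: mate)
qed

end
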